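(* Let $\lambda\in\mathbf{k}$ and let $(A,\prec,\succ,\bullet)$ be a tridendriform algebra of weight $\lambda$. Define $$[x,y]:=x\bullet y-y\bullet x,\qquad x\circ y:=x\succ y-y\prec x,\quad x,y\in A.$$ Then $(A,[\,,\,],\circ)$ is a post-Lie algebra of weight $\lambda$.
   Context: $\mathbf{k}$ is a field of characteristic $0$; all operations are bilinear. A tridendriform algebra of weight $\lambda$ is a vector space $A$ with three binary operations $\prec,\succ,\bullet$ such that, with $\star_\lambda:=\prec+\succ+\lambda\bullet$, for all $x,y,z\in A$: $(x\prec y)\prec z=x\prec(y\star_\lambda z)$; $(x\succ y)\prec z=x\succ(y\prec z)$; $(x\star_\lambda y)\succ z=x\succ(y\succ z)$; $(x\succ y)\bullet z=x\succ(y\bullet z)$; $(x\prec y)\bullet z=x\bullet(y\succ z)$; $(x\bullet y)\prec z=x\bullet(y\prec z)$; $(x\bullet y)\bullet z=x\bullet(y\bullet z)$. A post-Lie algebra of weight $\lambda$ is a vector space $A$ with a Lie bracket $[\,,\,]$ and a binary operation $\circ$ such that for all $x,y,z\in A$: $(x\circ y)\circ z-(y\circ x)\circ z+\lambda[x,y]\circ z=x\circ(y\circ z)-y\circ(x\circ z)$ and $x\circ[y,z]=[x\circ y,z]+[y,x\circ z]$. *)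

theory Defs
  imports Complex_Main
begin

locale bilinear_operation = vector_space scale
  for scale :: "'k::field_char_0 \<Rightarrow> 'a::ab_group_add \<Rightarrow> 'a" +
  fixes f :: "'a \<Rightarrow> 'a \<Rightarrow> 'a"
  assumes linear_left: "Vector_Spaces.linear scale scale (\<lambda>x. f x y)"
    and linear_right: "Vector_Spaces.linear scale scale (\<lambda>y. f x y)"

definition tri_star ::
  "('k::field_char_0 \<Rightarrow> 'a::ab_group_add \<Rightarrow> 'a) \<Rightarrow> 'k \<Rightarrow>
    ('a \<Rightarrow> 'a \<Rightarrow> 'a) \<Rightarrow> ('a \<Rightarrow> 'a \<Rightarrow> 'a) \<Rightarrow> ('a \<Rightarrow> 'a \<Rightarrow> 'a) \<Rightarrow> 'a \<Rightarrow> 'a \<Rightarrow> 'a"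
  where "tri_star scale wt lt gt bul x y = lt x y + gt x y + scale wt (bul x y)"

locale tridendriform_algebra =
  lt: bilinear_operation scale lt +
  gt: bilinear_operation scale gt +
  bul: bilinear_operation scale bul
  for scale :: "'k::field_char_0 \<Rightarrow> 'a::ab_group_add \<Rightarrow> 'a"
    and wt :: 'k
    and lt :: "'a \<Rightarrow> 'a \<Rightarrow> 'a" (infixl "\<prec>" 70)
    and gt :: "'a \<Rightarrow> 'a \<Rightarrow> 'a" (infixl "\<succ>" 70)
    and bul :: "'a \<Rightarrow> 'a \<Rightarrow> 'a" (infixl "\<bullet>" 70) +
  assumes lt_lt: "(x \<prec> y) \<prec> z = x \<prec> tri_star scale wt (\<prec>) (\<succ>) (\<bullet>) y z"
    and gt_lt: "(x \<succ> y) \<prec> z = x \<succ> (y \<prec> z)"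
    and star_gt: "tri_star scale wt (\<prec>) (\<succ>) (\<bullet>) x y \<succ> z = x \<succ> (y \<succ> z)"
    and gt_bul: "(x \<succ> y) \<bullet> z = x \<succ> (y \<bullet> z)"
    and lt_bul: "(x \<prec> y) \<bullet> z = x \<bullet> (y \<succ> z)"
    and bul_lt: "(x \<bullet> y) \<prec> z = x \<bullet> (y \<prec> z)"
    and bul_bul: "(x \<bullet> y) \<bullet> z = x \<bullet> (y \<bullet> z)"

locale lie_algebra = bilinear_operation scale br
  for scale :: "'k::field_char_0 \<Rightarrow> 'a::ab_group_add \<Rightarrow> 'a"
    and br :: "'a \<Rightarrow> 'a \<Rightarrow> 'a" +
  assumes alternating: "br x x = 0"
    and jacobi: "br x (br y z) + br y (br z x) + br z (br x y) = 0"

locale post_lie_algebra =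
  lie_algebra scale br + circ: bilinear_operation scale circ
  for scale :: "'k::field_char_0 \<Rightarrow> 'a::ab_group_add \<Rightarrow> 'a"
    and wt :: 'k
    and br :: "'a \<Rightarrow> 'a \<Rightarrow> 'a"
    and circ :: "'a \<Rightarrow> 'a \<Rightarrow> 'a" (infixl "\<circ>\<circ>" 70) +
  assumes post_lie:
      "(x \<circ>\<circ> y) \<circ>\<circ> z - (y \<circ>\<circ> x) \<circ>\<circ> z + scale wt (br x y) \<circ>\<circ> z
        = x \<circ>\<circ> (y \<circ>\<circ> z) - y \<circ>\<circ> (x \<circ>\<circ> z)"
    and derivation: "x \<circ>\<circ> br y z = br (x \<circ>\<circ> y) z + br y (x \<circ>\<circ> z)"

end

theory Submission
  imports Defs
begin

text \<open>
  The operation \<open>x \<circ> y = x \<succ> y - y \<prec> x\<close> is left multiplication minus right multiplication. The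
  tridendriform axioms say that \<open>\<succ>\<close> and \<open>\<prec>\<close> are commuting left and right actions of the product
  \<open>\<star> = (\<prec>) + (\<succ>) + \<lambda> (\<bullet>)\<close>, and so \<open>\<circ>\<close> is an action of the commutator of \<open>\<star>\<close>, just as the adjoint
  action is one for an associative algebra. That commutator is \<open>x \<circ> y - y \<circ> x + \<lambda> [x, y]\<close>, because
  the one-sided products pair up as \<open>x \<prec> y - y \<succ> x = - (y \<circ> x)\<close>; hence this action property is
  exactly the post-Lie identity (lemmas \<open>star_commutator\<close> and \<open>circ_star_commutator\<close>).

  The remaining axioms make \<open>x \<circ> -\<close> a derivation of the associative product \<open>\<bullet>\<close>: left
  multiplication by \<open>x\<close> acts on the first factor, right multiplication on the second, and the two
  middle terms \<open>(y \<prec> x) \<bullet> z\<close> and \<open>y \<bullet> (x \<succ> z)\<close> cancel (lemma \<open>circ_bul\<close>). A derivation of an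
  associative product is one of its commutator, which is a Lie bracket.
\<close>

context bilinear_operation
begin

lemma add_left: "f (x + y) z = f x z + f y z"
  by (rule module_hom.add[OF linear_left[unfolded linear_iff_module_hom]])

lemma diff_left: "f (x - y) z = f x z - f y z"
  by (rule module_hom.diff[OF linear_left[unfolded linear_iff_module_hom]])

lemma diff_right: "f x (y - z) = f x y - f x z"
  by (rule module_hom.diff[OF linear_right[unfolded linear_iff_module_hom]])

lemma bilinear_operation_flip: "bilinear_operation scale (\<lambda>x y. f y x)"
  by (intro bilinear_operation.intro bilinear_operation_axioms.intro
      vector_space_axioms linear_left linear_right)

end

lemma bilinear_operation_diff:
  assumes "bilinear_operation scale f" and "bilinear_operation scale g"
  shows "bilinear_operation scale (\<lambda>x y. f x y - g x y)"
proof -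
  interpret f: bilinear_operation scale f by fact
  interpret g: bilinear_operation scale g by fact
  interpret vector_space_pair scale scale ..
  show ?thesis
    by (intro bilinear_operation.intro bilinear_operation_axioms.intro
        f.vector_space_axioms linear_compose_sub
        f.linear_left g.linear_left f.linear_right g.linear_right)
qed

lemma lie_algebra_commutator:
  assumes "bilinear_operation scale m"
    and assoc: "\<And>x y z. m (m x y) z = m x (m y z)"
  shows "lie_algebra scale (\<lambda>x y. m x y - m y x)"
proof -
  interpret m: bilinear_operation scale m by fact
  interpret br: bilinear_operation scale "\<lambda>x y. m x y - m y x"
    by (intro bilinear_operation_diff m.bilinear_operation_flip assms)
  show ?thesis
    by unfold_locales (simp_all add: m.diff_left m.diff_right assoc)
qed

context tridendriform_algebra
begin

abbreviation star :: "'a \<Rightarrow> 'a \<Rightarrow> 'a" (infixl "\<star>" 70)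
  where "x \<star> y \<equiv> tri_star scale wt (\<prec>) (\<succ>) (\<bullet>) x y"

abbreviation tri_circ :: "'a \<Rightarrow> 'a \<Rightarrow> 'a" (infixl "\<circ>\<circ>" 70)
  where "x \<circ>\<circ> y \<equiv> x \<succ> y - y \<prec> x"

lemma bilinear_operation_tri_circ: "bilinear_operation scale (\<circ>\<circ>)"
  by (intro bilinear_operation_diff lt.bilinear_operation_flip
      gt.bilinear_operation_axioms)

lemma star_commutator:
  "x \<star> y - y \<star> x = x \<circ>\<circ> y - y \<circ>\<circ> x + scale wt (x \<bullet> y - y \<bullet> x)"
  by (simp add: tri_star_def lt.scale_right_diff_distrib)

text \<open>
  The left action of \<open>x \<star> y\<close> contributes \<open>x \<succ> (y \<succ> z)\<close> and the right action
  \<open>(z \<prec> x) \<prec> y\<close>. On the right-hand side the mixed terms \<open>x \<succ> (z \<prec> y)\<close> and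
  \<open>(y \<succ> z) \<prec> x = y \<succ> (z \<prec> x)\<close> add up to an expression symmetric in \<open>x\<close> and \<open>y\<close>, which
  antisymmetrization removes.
\<close>

lemma circ_star_commutator:
  "(x \<star> y - y \<star> x) \<circ>\<circ> z = x \<circ>\<circ> (y \<circ>\<circ> z) - y \<circ>\<circ> (x \<circ>\<circ> z)"
  by (simp add: gt.diff_left gt.diff_right lt.diff_left lt.diff_right
      star_gt gt_lt flip: lt_lt)

text \<open>
  The cross terms \<open>(y \<prec> x) \<bullet> z\<close> and \<open>y \<bullet> (x \<succ> z)\<close> enter with opposite signs and are equal.
\<close>

lemma circ_bul: "x \<circ>\<circ> (y \<bullet> z) = (x \<circ>\<circ> y) \<bullet> z + y \<bullet> (x \<circ>\<circ> z)"
  by (simp add: bul.diff_left bul.diff_right gt_bul lt_bul bul_lt)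

end

theorem corollary2p16:
  fixes scale :: "'k::field_char_0 \<Rightarrow> 'a::ab_group_add \<Rightarrow> 'a"
    and wt :: 'k
    and lt gt bul :: "'a \<Rightarrow> 'a \<Rightarrow> 'a"
  assumes "tridendriform_algebra scale wt lt gt bul"
  shows "post_lie_algebra scale wt
           (\<lambda>x y. bul x y - bul y x)
           (\<lambda>x y. gt x y - lt y x)"
proof -
  interpret tridendriform_algebra scale wt lt gt bul by fact
  interpret br: lie_algebra scale "\<lambda>x y. bul x y - bul y x"
    by (intro lie_algebra_commutator bul.bilinear_operation_axioms bul_bul)
  interpret circ: bilinear_operation scale tri_circ
    by (rule bilinear_operation_tri_circ)
  show ?thesis
  proof unfold_locales
    fix x y z
    show "tri_circ (tri_circ x y) z - tri_circ (tri_circ y x) z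
        + tri_circ (scale wt (bul x y - bul y x)) z
        = tri_circ x (tri_circ y z) - tri_circ y (tri_circ x z)"
      unfolding circ.diff_left[symmetric] circ.add_left[symmetric]
        star_commutator[symmetric]
      by (rule circ_star_commutator)
    show "tri_circ x (bul y z - bul z y)
        = (bul (tri_circ x y) z - bul z (tri_circ x y))
          + (bul y (tri_circ x z) - bul (tri_circ x z) y)"
      unfolding circ.diff_right circ_bul by simp
  qed
qed

end
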